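(* Let $t\ge 2$ be an integer. Then the (outerplanar) graph $H(2t-2)$ is $(\frac{4}{2},t+1)^*$-colorable, but is not $(\frac{4}{2},t)^*$-colorable.
   Context: For an integer $m\ge 1$, $H(m)$ is the graph with vertex set $\{x,x_1,\dots,x_m\}\cup\{y,y_1,\dots,y_m\}\cup\{z,z_1,\dots,z_m\}$ and edge set the union of $\{x_ix_{i+1}: 1\le i\le m-1\}$, $\{y_iy_{i+1}: 1\le i\le m-1\}$, $\{z_iz_{i+1}: 1\le i\le m-1\}$, $\{x_my,\ y_mz,\ z_mx,\ xy,\ yz,\ zx\}$, $\{xx_i:1\le i\le m\}$, $\{yy_i:1\le i\le m\}$ and $\{zz_i:1\le i\le m\}$. It is an outerplanar graph (it has a planar drawing in which all vertices lie on the outer face). For a positive integer $k$ and $i,j\in\{0,1,\dots,k-1\}$, the circular distance is $|i-j|_k=\min\{|i-j|,\,k-|i-j|\}$. For a nonnegative integer $t$, a $(\frac{k}{2},t)^*$-coloring of a graph $G$ is a mapping $f:V(G)\to\{0,1,\dots,k-1\}$ such that adjacent vertices receive different integers and, for each vertex $u$, the number of neighbors $v$ of $u$ with $|f(u)-f(v)|_k=1$ is at most $t$. $G$ is $(\frac{k}{2},t)^*$-colorable if it has such a coloring. (The symbol $\frac{k}{2}$ is formal notation recording the pair $(k,2)$, not a reduced fraction; so $\frac{4}{2}$ means $k=4$.) *)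

theory Defs
  imports "HOL-Analysis.Analysis"
begin

(* A graph is a pair of a vertex set and a set of edges, an edge being the set of its two ends. *)
type_synonym 'a graph = "'a set \<times> 'a set set"

abbreviation verts :: "'a graph \<Rightarrow> 'a set" where "verts G \<equiv> fst G"
abbreviation edges :: "'a graph \<Rightarrow> 'a set set" where "edges G \<equiv> snd G"

definition simple_graph :: "'a graph \<Rightarrow> bool" where
  "simple_graph G \<longleftrightarrow> finite (verts G) \<and> (\<forall>e\<in>edges G. e \<subseteq> verts G \<and> card e = 2)"

definition neighbors :: "'a graph \<Rightarrow> 'a \<Rightarrow> 'a set" where
  "neighbors G u = {v \<in> verts G. {u, v} \<in> edges G}"

definition circ_dist :: "nat \<Rightarrow> nat \<Rightarrow> nat \<Rightarrow> int" where
  "circ_dist k i j = min \<bar>int i - int j\<bar> (int k - \<bar>int i - int j\<bar>)"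

(* The (k/2,t)*-colorings of a finite graph; k/2 is formal notation, so the (4/2,t)*-colorings
   are those with k = 4. *)
definition half_coloring :: "nat \<Rightarrow> nat \<Rightarrow> 'a graph \<Rightarrow> ('a \<Rightarrow> nat) \<Rightarrow> bool" where
  "half_coloring k t G f \<longleftrightarrow>
     (\<forall>u\<in>verts G. f u \<in> {..<k}) \<and>
     (\<forall>u\<in>verts G. \<forall>v\<in>neighbors G u. f u \<noteq> f v) \<and>
     (\<forall>u\<in>verts G. card {v \<in> neighbors G u. circ_dist k (f u) (f v) = 1} \<le> t)"

definition half_colorable :: "nat \<Rightarrow> nat \<Rightarrow> 'a graph \<Rightarrow> bool" where
  "half_colorable k t G \<longleftrightarrow> (\<exists>f. half_coloring k t G f)"

(* A drawing in the plane: pos places the vertices, arcs e is a simple arc joining the ends of e.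
   Two arcs may meet only at a common end, and an arc passes through no vertex but its ends. *)
definition planar_drawing ::
  "'a graph \<Rightarrow> ('a \<Rightarrow> complex) \<Rightarrow> ('a set \<Rightarrow> real \<Rightarrow> complex) \<Rightarrow> bool" where
  "planar_drawing G pos arcs \<longleftrightarrow>
     inj_on pos (verts G) \<and>
     (\<forall>e\<in>edges G. arc (arcs e) \<and> {pathstart (arcs e), pathfinish (arcs e)} = pos ` e \<and>
        path_image (arcs e) \<inter> pos ` verts G = pos ` e) \<and>
     (\<forall>e\<in>edges G. \<forall>e'\<in>edges G. e \<noteq> e' \<longrightarrow>
        path_image (arcs e) \<inter> path_image (arcs e') = pos ` (e \<inter> e'))"

definition drawing_image ::
  "'a graph \<Rightarrow> ('a \<Rightarrow> complex) \<Rightarrow> ('a set \<Rightarrow> real \<Rightarrow> complex) \<Rightarrow> complex set" where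
  "drawing_image G pos arcs = pos ` verts G \<union> (\<Union>e\<in>edges G. path_image (arcs e))"

(* The outer face of a drawing of a finite graph is the unbounded component of the complement,
   which is what outside denotes; a vertex lies on this face if it is on its boundary. *)
definition outerplanar :: "'a graph \<Rightarrow> bool" where
  "outerplanar G \<longleftrightarrow> simple_graph G \<and> (\<exists>pos arcs. planar_drawing G pos arcs \<and>
     pos ` verts G \<subseteq> frontier (outside (drawing_image G pos arcs)))"

(* X, Y, Z are the vertices x, y, z, and Xs i, Ys i, Zs i are x_i, y_i, z_i. *)
datatype hvertex = X | Y | Z | Xs nat | Ys nat | Zs nat

definition H :: "nat \<Rightarrow> hvertex graph" where
  "H m =
     (insert X (Xs ` {1..m}) \<union> insert Y (Ys ` {1..m}) \<union> insert Z (Zs ` {1..m}),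
      {{Xs i, Xs (i + 1)} | i. 1 \<le> i \<and> i + 1 \<le> m} \<union>
      {{Ys i, Ys (i + 1)} | i. 1 \<le> i \<and> i + 1 \<le> m} \<union>
      {{Zs i, Zs (i + 1)} | i. 1 \<le> i \<and> i + 1 \<le> m} \<union>
      {{Xs m, Y}, {Ys m, Z}, {Zs m, X}, {X, Y}, {Y, Z}, {Z, X}} \<union>
      {{X, Xs i} | i. 1 \<le> i \<and> i \<le> m} \<union>
      {{Y, Ys i} | i. 1 \<le> i \<and> i \<le> m} \<union>
      {{Z, Zs i} | i. 1 \<le> i \<and> i \<le> m})"

lemma simple_graph_H: "1 \<le> m \<Longrightarrow> simple_graph (H m)"
  by (auto simp: simple_graph_def H_def)

end

theory Submission
  imports Defs
begin

text \<open>
  Modulo 4 two distinct colours are at circular distance 1 exactly when their parities differ.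
  Hence in a properly coloured triangle the three parities are not all equal, so by rotation we
  may assume that \<open>x\<close> and \<open>y\<close> have different parities. Besides \<open>y\<close>, the vertex \<open>x\<close> then has one
  neighbour of the other parity in each of the \<open>t - 1\<close> pairs \<open>{x\<^sub>2\<^sub>j\<^sub>-\<^sub>1, x\<^sub>2\<^sub>j}\<close> and one in
  \<open>{z, z\<^sub>m}\<close>, which makes \<open>t + 1\<close>. For outerplanarity, place the vertices on a parabola in the
  order of the Hamiltonian cycle \<open>x, x\<^sub>1, \<dots>, x\<^sub>m, y, y\<^sub>1, \<dots>, y\<^sub>m, z, z\<^sub>1, \<dots>, z\<^sub>m\<close> and draw the
  edges as chords.
\<close>

subsection \<open>Chords of a parabola\<close>

definition parab :: "nat \<Rightarrow> complex" where
  "parab k = Complex (real k) ((real k)\<^sup>2)"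

lemma parab_eq_iff [simp]: "parab a = parab b \<longleftrightarrow> a = b"
  by (auto simp: parab_def)

text \<open>The secant is y = (a + b) x - a b. Written as x^2 plus an excess, it shows the height of
  the chord over the parabola; the intersection lemmas compare these excesses.\<close>

lemma chord_param:
  assumes "a < b" "z \<in> closed_segment (parab a) (parab b)"
  shows "real a \<le> Re z" "Re z \<le> real b" "Im z = (Re z)\<^sup>2 + (Re z - real a) * (real b - Re z)"
proof -
  from assms(2) obtain u where u: "0 \<le> u" "u \<le> 1"
    and z: "z = (1 - u) *\<^sub>R parab a + u *\<^sub>R parab b"
    by (auto simp: closed_segment_def)
  have re: "Re z = real a + u * (real b - real a)"
    by (simp add: z parab_def algebra_simps)
  show "real a \<le> Re z"
    using re u assms(1) by simp
  have "real b - Re z = (1 - u) * (real b - real a)"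
    by (simp add: re algebra_simps)
  moreover have "0 \<le> (1 - u) * (real b - real a)"
    using u assms(1) by simp
  ultimately show "Re z \<le> real b" by simp
  show "Im z = (Re z)\<^sup>2 + (Re z - real a) * (real b - Re z)"
    unfolding re by (simp add: z parab_def algebra_simps power2_eq_square)
qed

lemma on_parab_eqI:
  assumes "Re z = real k" "Im z = (Re z)\<^sup>2"
  shows "z = parab k"
  using assms by (simp add: parab_def complex_eq_iff)

lemma chord_meets_parab:
  assumes "a < b" "parab k \<in> closed_segment (parab a) (parab b)"
  shows "k = a \<or> k = b"
  using chord_param(3)[OF assms] by (auto simp: parab_def)

lemma chords_meet_disjoint:
  assumes "a < b" "c < d" "b \<le> c"
    and "z \<in> closed_segment (parab a) (parab b)" "z \<in> closed_segment (parab c) (parab d)"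
  shows "b = c \<and> z = parab b"
proof -
  note 1 = chord_param[OF assms(1,4)] and 2 = chord_param[OF assms(2,5)]
  have "Re z = real b" "real b = real c"
    using 1 2 assms(3) by linarith+
  then show ?thesis
    using 1 by (auto intro: on_parab_eqI)
qed

text \<open>At abscissa s the excess of the outer chord minus that of the inner one is (c - a)(d -
  s) + (s - a)(b - d). Both summands are nonnegative, so at a common point both vanish.\<close>

lemma chords_meet_nested:
  assumes "a \<le> c" "c < d" "d \<le> b" "a \<noteq> c \<or> b \<noteq> d"
    and "z \<in> closed_segment (parab a) (parab b)" "z \<in> closed_segment (parab c) (parab d)"
  shows "(a = c \<and> z = parab a) \<or> (b = d \<and> z = parab b)"
proof -
  have "a < b" using assms by linarith
  note 1 = chord_param[OF this assms(5)] and 2 = chord_param[OF assms(2,6)]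
  define s where "s = Re z"
  have eq: "(s - a) * (b - s) = (s - c) * (d - s)"
    using 1(3) 2(3) by (simp add: s_def)
  have "(s - a) * (b - s) - (s - c) * (d - s)
      = (real c - real a) * (d - s) + (s - a) * (real b - real d)"
    by (simp add: algebra_simps)
  then have sum0: "(real c - real a) * (d - s) + (s - a) * (real b - real d) = 0"
    using eq by simp
  have "0 \<le> (real c - real a) * (d - s)" "0 \<le> (s - a) * (real b - real d)"
    using assms 1 2 by (auto simp: s_def intro!: mult_nonneg_nonneg)
  then have zero: "(real c - real a) * (d - s) = 0" "(s - a) * (real b - real d) = 0"
    using sum0 by linarith+
  show ?thesis
  proof (cases "a = c")
    case True
    then have "s = a" using zero(2) assms(4) by auto
    then show ?thesis using True 1 by (auto simp: s_def intro: on_parab_eqI)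
  next
    case False
    then have "s = d" using zero(1) by auto
    moreover from this have "b = d" using zero(2) False assms(1,2) by auto
    ultimately show ?thesis using 1 by (auto simp: s_def intro: on_parab_eqI)
  qed
qed

lemma chords_meet:
  assumes "a < b" "c < d" "(a, b) \<noteq> (c, d)"
    and "\<not> (a < c \<and> c < b \<and> b < d)" "\<not> (c < a \<and> a < d \<and> d < b)"
    and "z \<in> closed_segment (parab a) (parab b)" "z \<in> closed_segment (parab c) (parab d)"
  shows "z \<in> parab ` ({a, b} \<inter> {c, d})"
proof -
  \<comment> \<open>Intervals that do not strictly interleave are separated, up to a shared end, or
    nested.\<close>
  consider "b \<le> c" | "d \<le> a" | "a \<le> c" "d \<le> b" | "c \<le> a" "b \<le> d"
    using assms by linarith
  then show ?thesis
  proof cases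
    case 1
    with chords_meet_disjoint[of a b c d z] assms show ?thesis by auto
  next
    case 2
    with chords_meet_disjoint[of c d a b z] assms show ?thesis by auto
  next
    case 3
    with chords_meet_nested[of a c d b z] assms show ?thesis by auto
  next
    case 4
    with chords_meet_nested[of c a b d z] assms show ?thesis by auto
  qed
qed

text \<open>The tangent at \<open>parab k\<close> supports the hull, so points just below it lie
  outside the drawing and come arbitrarily close to \<open>parab k\<close>.\<close>

lemma parab_frontier_outside:
  assumes "D \<subseteq> convex hull (parab ` I)" "finite I" "parab k \<in> D"
  shows "parab k \<in> frontier (outside D)"
proof -
  define C where "C = convex hull (parab ` I)"
  have C: "convex C" "bounded C"
    using assms(2) by (auto simp: C_def finite_imp_bounded bounded_convex_hull)
  \<comment> \<open>The closed half-plane above the tangent y = 2 k x - k^2.\<close>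
  define T where "T = {z. inner (Complex (2 * real k) (-1)) z \<le> (real k)\<^sup>2}"
  have "parab ` I \<subseteq> T"
  proof clarify
    fix j
    have "0 \<le> (real j - real k)\<^sup>2" by simp
    then show "parab j \<in> T"
      by (simp add: T_def parab_def inner_complex_def power2_eq_square algebra_simps)
  qed
  then have "C \<subseteq> T"
    unfolding C_def by (rule hull_minimal) (simp add: T_def convex_halfspace_le)
  \<comment> \<open>The outside of a convex set is its whole complement, and \<open>outside\<close>
    is antitone.\<close>
  then have out: "- T \<subseteq> outside D"
    using outside_convex[OF C(1)] outside_mono[of D C] assms(1) C_def by blast
  have "parab k \<in> closure (outside D)"
    unfolding closure_approachable
  proof (intro allI impI)
    fix e :: real assume "0 < e"
    define w where "w = parab k - Complex 0 (e / 2)"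
    have "w \<in> - T"
      using \<open>0 < e\<close> by (simp add: w_def T_def parab_def inner_complex_def power2_eq_square)
    moreover have "dist w (parab k) < e"
      using \<open>0 < e\<close> by (simp add: w_def dist_norm complex_norm)
    ultimately show "\<exists>y\<in>outside D. dist y (parab k) < e"
      using out by blast
  qed
  moreover have "parab k \<notin> interior (outside D)"
    using assms(3) interior_subset[of "outside D"] outside_no_overlap[of D] by blast
  ultimately show ?thesis by (simp add: frontier_def)
qed

text \<open>Edges are unordered pairs, so the single pattern in \<open>noncross\<close> covers every
  crossing once it is applied to the two edges in both orders.\<close>

lemma outerplanar_if_noncrossing:
  fixes idx :: "'a \<Rightarrow> nat"
  assumes G: "simple_graph G" and inj: "inj_on idx (verts G)"
    and noncross: "\<And>a b c d. \<lbrakk>{a, b} \<in> edges G; {c, d} \<in> edges G;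
      idx a < idx c; idx c < idx b; idx b < idx d\<rbrakk> \<Longrightarrow> False"
  shows "outerplanar G"
proof -
  define pos where "pos = parab \<circ> idx"
  \<comment> \<open>\<open>Min\<close> and \<open>Max\<close> orient each chord from left to right
    without choosing an end of \<open>e\<close>.\<close>
  define arcs where "arcs e = linepath (parab (Min (idx ` e))) (parab (Max (idx ` e)))" for e
  have edgeE: "\<exists>a b. e = {a, b} \<and> a \<in> verts G \<and> b \<in> verts G \<and> idx a < idx b \<and>
      arcs e = linepath (parab (idx a)) (parab (idx b))" if "e \<in> edges G" for e
  proof -
    from G that have "e \<subseteq> verts G" "card e = 2" by (auto simp: simple_graph_def)
    then obtain a b where ab: "e = {a, b}" "a \<noteq> b" "a \<in> verts G" "b \<in> verts G"
      by (auto simp: card_2_iff)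
    then have "idx a \<noteq> idx b" using inj by (auto dest: inj_onD)
    then consider "idx a < idx b" | "idx b < idx a" by linarith
    then show ?thesis
    proof cases
      case 1
      with ab show ?thesis
        by (intro exI[of _ a] exI[of _ b]) (auto simp: arcs_def min_def max_def)
    next
      case 2
      with ab show ?thesis
        by (intro exI[of _ b] exI[of _ a]) (auto simp: arcs_def min_def max_def)
    qed
  qed
  have draw: "planar_drawing G pos arcs"
    unfolding planar_drawing_def
  proof (intro conjI ballI impI)
    show "inj_on pos (verts G)"
      using inj by (auto simp: pos_def inj_on_def)
  next
    fix e assume "e \<in> edges G"
    from edgeE[OF this] obtain a b where e: "e = {a, b}" "a \<in> verts G" "b \<in> verts G"
      "idx a < idx b" "arcs e = linepath (parab (idx a)) (parab (idx b))" by blast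
    show "arc (arcs e)" "{pathstart (arcs e), pathfinish (arcs e)} = pos ` e"
      using e by (auto simp: pos_def)
    show "path_image (arcs e) \<inter> pos ` verts G = pos ` e"
      using e chord_meets_parab[OF e(4)] by (fastforce simp: pos_def)
  next
    fix e e' assume ee: "e \<in> edges G" "e' \<in> edges G" "e \<noteq> e'"
    from edgeE[OF ee(1)] obtain a b where e: "e = {a, b}" "a \<in> verts G" "b \<in> verts G"
      "idx a < idx b" "arcs e = linepath (parab (idx a)) (parab (idx b))" by blast
    from edgeE[OF ee(2)] obtain c d where e': "e' = {c, d}" "c \<in> verts G" "d \<in> verts G"
      "idx c < idx d" "arcs e' = linepath (parab (idx c)) (parab (idx d))" by blast
    have ne: "(idx a, idx b) \<noteq> (idx c, idx d)"
      using ee(3) e e' inj by (auto dest: inj_onD)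
    have idx_Int: "{idx a, idx b} \<inter> {idx c, idx d} = idx ` (e \<inter> e')"
      using e e' inj inj_on_image_Int[of idx "verts G" e e'] by auto
    have "path_image (arcs e) \<inter> path_image (arcs e') \<subseteq> parab ` ({idx a, idx b} \<inter> {idx c, idx d})"
      using chords_meet[OF e(4) e'(4) ne] noncross[of a b c d] noncross[of c d a b] e e' ee
      by auto
    moreover have "parab ` ({idx a, idx b} \<inter> {idx c, idx d})
        \<subseteq> path_image (arcs e) \<inter> path_image (arcs e')"
      using e e' by auto
    ultimately show "path_image (arcs e) \<inter> path_image (arcs e') = pos ` (e \<inter> e')"
      unfolding pos_def image_comp [symmetric] idx_Int [symmetric] by (rule equalityI)
  qed
  have hull: "drawing_image G pos arcs \<subseteq> convex hull (parab ` (idx ` verts G))"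
  proof -
    have "path_image (arcs e) \<subseteq> convex hull (parab ` (idx ` verts G))" if "e \<in> edges G" for e
    proof -
      from edgeE[OF that] obtain a b where e: "e = {a, b}" "a \<in> verts G" "b \<in> verts G"
        "arcs e = linepath (parab (idx a)) (parab (idx b))" by blast
      then show ?thesis
        by (simp add: closed_segment_subset hull_inc)
    qed
    moreover have "pos ` verts G \<subseteq> convex hull (parab ` (idx ` verts G))"
      by (auto simp: pos_def intro: hull_inc)
    ultimately show ?thesis by (auto simp: drawing_image_def)
  qed
  have "pos v \<in> frontier (outside (drawing_image G pos arcs))" if "v \<in> verts G" for v
  proof -
    have "pos v \<in> drawing_image G pos arcs" using that by (auto simp: drawing_image_def)
    moreover have "finite (idx ` verts G)" using G by (simp add: simple_graph_def)
    ultimately show ?thesis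
      using parab_frontier_outside[OF hull] by (simp add: pos_def)
  qed
  then show ?thesis
    using G draw by (auto simp: outerplanar_def)
qed

subsection \<open>Outerplanarity of $H(m)$\<close>

text \<open>Three consecutive blocks of m + 1 positions, each a hub followed by its path.\<close>

fun hidx :: "nat \<Rightarrow> hvertex \<Rightarrow> nat" where
  "hidx m X = 0"
| "hidx m (Xs i) = i"
| "hidx m Y = m + 1"
| "hidx m (Ys i) = m + 1 + i"
| "hidx m Z = 2 * (m + 1)"
| "hidx m (Zs i) = 2 * (m + 1) + i"

lemma inj_on_hidx: "inj_on (hidx m) (verts (H m))"
  by (auto simp: inj_on_def H_def)

text \<open>The cases are steps along the cycle, chords from x, y and z within their fans
  (\<open>xy\<close> and \<open>yz\<close> counted with the fans of x and y), and the two chords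
  from x to z and z_m.\<close>

lemma hidx_edge:
  assumes "{a, b} \<in> edges (H m)" "p = hidx m a" "q = hidx m b" "p < q"
  shows "q = p + 1 \<or> (p = 0 \<and> q \<le> m + 1) \<or> (p = m + 1 \<and> q \<le> 2 * m + 2) \<or>
    (p = 2 * m + 2 \<and> q \<le> 3 * m + 2) \<or> (p = 0 \<and> (q = 2 * m + 2 \<or> q = 3 * m + 2))"
  using assms by (auto simp: H_def doubleton_eq_iff)

lemma hidx_edge_le:
  assumes "{a, b} \<in> edges (H m)" "1 \<le> m"
  shows "hidx m b \<le> 3 * m + 2"
  using assms by (auto simp: H_def doubleton_eq_iff)

lemma outerplanar_H:
  assumes "1 \<le> m"
  shows "outerplanar (H m)"
proof (rule outerplanar_if_noncrossing[OF simple_graph_H[OF assms] inj_on_hidx])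
  fix a b c d
  assume ab: "{a, b} \<in> edges (H m)" and cd: "{c, d} \<in> edges (H m)"
    and less: "hidx m a < hidx m c" "hidx m c < hidx m b" "hidx m b < hidx m d"
  note 1 = hidx_edge[OF ab refl refl] and 2 = hidx_edge[OF cd refl refl]
  \<comment> \<open>Position c comes after a, so it is not 0. Hence \<open>{c, d}\<close> is a cycle
    step or a chord from position m + 1 or 2m + 2 within its block, and no edge starting earlier
    ends strictly inside that block.\<close>
  show False
    using 1 2 less hidx_edge_le[OF cd assms] by linarith
qed

subsection \<open>Colorings\<close>

lemma circ_dist_4_eq_1_iff:
  assumes "i < 4" "j < 4"
  shows "circ_dist 4 i j = 1 \<longleftrightarrow> even i \<noteq> even j"
proof -
  have "i \<in> {0, 1, 2, 3}" "j \<in> {0, 1, 2, 3}" using assms by auto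
  then show ?thesis by (auto simp: circ_dist_def)
qed

text \<open>Each parity class contains only two of the four colours.\<close>

lemma parity_classes_4:
  fixes i j k :: nat
  assumes "i < 4" "j < 4" "k < 4" "i \<noteq> j" "j \<noteq> k" "i \<noteq> k"
  shows "even i \<noteq> even j \<or> even i \<noteq> even k"
proof -
  have "i \<in> {0, 1, 2, 3}" "j \<in> {0, 1, 2, 3}" "k \<in> {0, 1, 2, 3}" using assms by auto
  then show ?thesis using assms by auto
qed

lemma card_ge_one_per_pair:
  assumes "\<And>j. j < n \<Longrightarrow> P (2 * j + 1) \<or> P (2 * j + 2)"
  shows "n \<le> card {i \<in> {1..2 * n}. P i}"
  using assms
proof (induction n)
  case 0
  then show ?case by simp
next
  case (Suc n)
  let ?A = "{i \<in> {1..2 * n}. P i}"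
  from Suc.prems[of n] obtain k where k: "k \<in> {2 * n + 1, 2 * n + 2}" "P k" by auto
  have "Suc n \<le> card (insert k ?A)"
    using Suc k by auto
  also have "\<dots> \<le> card {i \<in> {1..2 * Suc n}. P i}"
    using k by (intro card_mono) auto
  finally show ?case .
qed

text \<open>Here \<open>u\<close> is a hub with path \<open>p\<close>, \<open>v\<close> and
  \<open>q\<close> complete a triangle at \<open>u\<close> off the path, and \<open>w\<close> is a
  further neighbour of the other parity. The count is n from the path, one from
  \<open>{v, q}\<close>, and \<open>w\<close>.\<close>

lemma fan_degree_bound:
  fixes p :: "nat \<Rightarrow> 'a"
  assumes col: "half_coloring 4 t G f" and G: "simple_graph G"
    and path: "\<And>i. 1 \<le> i \<Longrightarrow> i < 2 * n \<Longrightarrow> {p i, p (i + 1)} \<in> edges G"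
    and fan: "\<And>i. 1 \<le> i \<Longrightarrow> i \<le> 2 * n \<Longrightarrow> {u, p i} \<in> edges G"
    and triangle: "{u, v} \<in> edges G" "{u, q} \<in> edges G" "{v, q} \<in> edges G"
    and uw: "{u, w} \<in> edges G" "even (f u) \<noteq> even (f w)"
    and distinct: "inj_on p {1..2 * n}" "w \<notin> {v, q}" "{w, v, q} \<inter> p ` {1..2 * n} = {}"
  shows "n + 2 \<le> t"
proof -
  have edge: "a \<in> verts G" "b \<in> verts G" "b \<in> neighbors G a" "f a \<noteq> f b" "f a < 4" "f b < 4"
    if "{a, b} \<in> edges G" for a b
    using that col G by (auto simp: half_coloring_def simple_graph_def neighbors_def)
  define B where "B = {b \<in> neighbors G u. circ_dist 4 (f u) (f b) = 1}"
  have B: "b \<in> B" if "{u, b} \<in> edges G" "even (f u) \<noteq> even (f b)" for b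
    using that edge[OF that(1)] by (simp add: B_def circ_dist_4_eq_1_iff)
  have tri: "even (f u) \<noteq> even (f a) \<or> even (f u) \<noteq> even (f b)"
    if "{u, a} \<in> edges G" "{u, b} \<in> edges G" "{a, b} \<in> edges G" for a b
    using that by (intro parity_classes_4 edge)
  have "finite B"
    using G by (simp add: B_def neighbors_def simple_graph_def)
  define I where "I = {i \<in> {1..2 * n}. even (f u) \<noteq> even (f (p i))}"
  have "n \<le> card I"
    unfolding I_def
  proof (rule card_ge_one_per_pair)
    fix j assume "j < n"
    then show "even (f u) \<noteq> even (f (p (2 * j + 1))) \<or> even (f u) \<noteq> even (f (p (2 * j + 2)))"
      \<comment> \<open>Two consecutive path vertices form a triangle with the hub.\<close>
      using fan[of "2 * j + 1"] fan[of "2 * j + 2"] path[of "2 * j + 1"]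
      by (intro tri) (auto simp: numeral_2_eq_2)
  qed
  also have "card I = card (p ` I)"
    using distinct(1) by (intro card_image[symmetric]) (auto simp: I_def intro: inj_on_subset)
  finally have pI: "n \<le> card (p ` I)" .
  from tri[OF triangle] obtain r where r: "r \<in> {v, q}" "r \<in> B"
    using B triangle by blast
  have fin: "finite (p ` I)" by (simp add: I_def)
  have "n + 2 \<le> card (insert w (insert r (p ` I)))"
  proof -
    have "r \<notin> p ` I" "w \<notin> insert r (p ` I)"
      using r(1) distinct(2,3) by (auto simp: I_def)
    then show ?thesis using fin pI by simp
  qed
  also have "\<dots> \<le> card B"
  proof (rule card_mono[OF \<open>finite B\<close>])
    show "insert w (insert r (p ` I)) \<subseteq> B"
      using r(2) B[OF uw] B fan by (auto simp: I_def)
  qed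
  also have "\<dots> \<le> t"
    using col edge(1)[OF uw(1)] by (simp add: B_def half_coloring_def)
  finally show ?thesis .
qed

text \<open>The fan bound at x with \<open>w\<close> = y, and at y with \<open>w\<close> = z, forces
  all three hubs to share a parity, which the triangle xyz forbids. The extra triangles are x z z_m
  and y x x_m, where m = 2n.\<close>

lemma not_half_colorable_H:
  assumes "1 \<le> n" "t < n + 2"
  shows "\<not> half_colorable 4 t (H (2 * n))"
proof
  assume "half_colorable 4 t (H (2 * n))"
  then obtain f where f: "half_coloring 4 t (H (2 * n)) f" by (auto simp: half_colorable_def)
  have G: "simple_graph (H (2 * n))" using assms(1) by (intro simple_graph_H) simp
  note bound = fan_degree_bound[OF f G, where n = n]
  have "even (f X) = even (f Y)"
    by (rule ccontr, rule notE[OF leD[OF bound[of Xs X Z "Zs (2 * n)" Y]] assms(2)])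
      (use assms in \<open>auto simp: H_def inj_on_def doubleton_eq_iff\<close>)
  moreover have "even (f Y) = even (f Z)"
    by (rule ccontr, rule notE[OF leD[OF bound[of Ys Y X "Xs (2 * n)" Z]] assms(2)])
      (use assms in \<open>auto simp: H_def inj_on_def doubleton_eq_iff\<close>)
  moreover have "even (f X) \<noteq> even (f Y) \<or> even (f X) \<noteq> even (f Z)"
    using f by (intro parity_classes_4) (auto simp: half_coloring_def neighbors_def H_def)
  ultimately show False by simp
qed

text \<open>On each path, odd positions get the other colour of the hub's parity and even positions
  a colour of the opposite parity, so each hub meets exactly n conflicts on its own path.\<close>

fun hcol :: "hvertex \<Rightarrow> nat" where
  "hcol X = 0"
| "hcol Y = 2"
| "hcol Z = 1"
| "hcol (Xs i) = (if odd i then 2 else 1)"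
| "hcol (Ys i) = (if odd i then 0 else 3)"
| "hcol (Zs i) = (if odd i then 3 else 2)"

lemma hcol_less_4: "hcol u < 4"
  by (cases u) auto

text \<open>The even path length matters: x_m has an even index and thus colour 1, while colour 2
  would clash with y. The ends y_m and z_m behave likewise.\<close>

lemma hcol_proper:
  assumes "{u, v} \<in> edges (H (2 * n))"
  shows "hcol u \<noteq> hcol v"
  using assms by (auto simp: H_def doubleton_eq_iff split: if_splits)

lemma card_le_insert2_image:
  assumes "A \<subseteq> insert a (insert b (g ` {1..n}))"
  shows "card A \<le> n + 2"
proof -
  have "card A \<le> card (insert a (insert b (g ` {1..n})))"
    using assms by (intro card_mono) auto
  also have "\<dots> \<le> Suc (Suc (card (g ` {1..n})))"
    by (simp add: card_insert_if)
  also have "\<dots> \<le> n + 2"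
    using card_image_le[of "{1..n}" g] by simp
  finally show ?thesis .
qed

lemma card_le_3:
  assumes "A \<subseteq> {a, b, c}"
  shows "card A \<le> 3"
proof -
  have "card A \<le> card {a, b, c}" using assms by (intro card_mono) auto
  also have "\<dots> \<le> 3" by (simp add: card_insert_if)
  finally show ?thesis .
qed

lemma half_colorable_H:
  assumes "1 \<le> n"
  shows "half_colorable 4 (n + 2) (H (2 * n))"
  unfolding half_colorable_def half_coloring_def
proof (intro exI[of _ hcol] conjI ballI)
  fix u v assume "v \<in> neighbors (H (2 * n)) u"
  then show "hcol u \<noteq> hcol v" by (auto simp: neighbors_def intro!: hcol_proper)
next
  fix u assume u: "u \<in> verts (H (2 * n))"
  define B where "B = {v \<in> neighbors (H (2 * n)) u. circ_dist 4 (hcol u) (hcol v) = 1}"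
  have B: "B = {v. {u, v} \<in> edges (H (2 * n)) \<and> v \<in> verts (H (2 * n))
      \<and> even (hcol u) \<noteq> even (hcol v)}"
    by (auto simp: B_def neighbors_def circ_dist_4_eq_1_iff hcol_less_4)
  \<comment> \<open>Stated with \<open>Suc 0\<close>, the form into which the simplifier turns
    1.\<close>
  have even_image: "c i \<in> (\<lambda>j. c (2 * j)) ` {Suc 0..n}" if "even i" "Suc 0 \<le> i" "i \<le> 2 * n"
    for c :: "nat \<Rightarrow> hvertex" and i
    using that by (auto elim!: evenE)
  have "card B \<le> n + 2"
  proof (cases u)
    case X
    \<comment> \<open>Off its path x conflicts only with z, since y and z_m are even; z is repeated
      to fit the bound with two extra elements.\<close>
    have "B \<subseteq> insert Z (insert Z ((\<lambda>j. Xs (2 * j)) ` {1..n}))"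
      unfolding B X
      by (auto simp: H_def doubleton_eq_iff even_image[of _ Xs] split: if_splits)
    then show ?thesis by (rule card_le_insert2_image)
  next
    case Y
    \<comment> \<open>Both z and x_m have colour 1, so y attains n + 2.\<close>
    have "B \<subseteq> insert Z (insert (Xs (2 * n)) ((\<lambda>j. Ys (2 * j)) ` {1..n}))"
      unfolding B Y
      by (auto simp: H_def doubleton_eq_iff even_image[of _ Ys] split: if_splits)
    then show ?thesis by (rule card_le_insert2_image)
  next
    case Z
    \<comment> \<open>The remaining neighbour y_m has colour 3, of the same parity as z.\<close>
    have "B \<subseteq> insert X (insert Y ((\<lambda>j. Zs (2 * j)) ` {1..n}))"
      unfolding B Z
      by (auto simp: H_def doubleton_eq_iff even_image[of _ Zs] split: if_splits)
    then show ?thesis by (rule card_le_insert2_image)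
  next
    case (Xs i)
    \<comment> \<open>A path vertex has at most three neighbours, and 3 \<le> n + 2. For i = 1 the
      entry \<open>Xs 0\<close> is not a vertex, which is harmless in an inclusion.\<close>
    have "B \<subseteq> {X, Xs (i - 1), if i = 2 * n then Y else Xs (i + 1)}"
      unfolding B Xs by (auto simp: H_def doubleton_eq_iff)
    then have "card B \<le> 3" by (rule card_le_3)
    then show ?thesis using assms by simp
  next
    case (Ys i)
    have "B \<subseteq> {Y, Ys (i - 1), if i = 2 * n then Z else Ys (i + 1)}"
      unfolding B Ys by (auto simp: H_def doubleton_eq_iff)
    then have "card B \<le> 3" by (rule card_le_3)
    then show ?thesis using assms by simp
  next
    case (Zs i)
    have "B \<subseteq> {Z, Zs (i - 1), if i = 2 * n then X else Zs (i + 1)}"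
      unfolding B Zs by (auto simp: H_def doubleton_eq_iff)
    then have "card B \<le> 3" by (rule card_le_3)
    then show ?thesis using assms by simp
  qed
  then show "card {v \<in> neighbors (H (2 * n)) u. circ_dist 4 (hcol u) (hcol v) = 1} \<le> n + 2"
    by (simp add: B_def)
qed (simp add: hcol_less_4)

theorem theorem5p9:
  fixes t :: nat
  assumes "t \<ge> 2"
  shows "outerplanar (H (2 * t - 2)) \<and>
         half_colorable 4 (t + 1) (H (2 * t - 2)) \<and>
         \<not> half_colorable 4 t (H (2 * t - 2))"
proof -
  obtain n where t: "t = n + 1" and n: "1 \<le> n"
    using assms by (intro that[of "t - 1"]) auto
  have "2 * t - 2 = 2 * n" "t + 1 = n + 2" "t < n + 2"
    by (auto simp: t)
  then show ?thesis
    using outerplanar_H[of "2 * n"] half_colorable_H[OF n] not_half_colorable_H[OF n] n by simp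
qed

end
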